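(* Let $n\ge 2$ and $p\ge 1$ be integers, and let $\boldsymbol\theta_{i,j}=\boldsymbol\theta_{j,i}\in\mathbb R^n_+$ for $i,j=1,\ldots,p$. Let $W\in\mathbb R^{np\times np}$ be the symmetric block tridiagonal matrix generated by the $\boldsymbol\theta_{i,j}$, as defined in the context. (a) If $W$ is positive semidefinite (PSD), then there exist PSD matrices $\widetilde W^1,\ldots,\widetilde W^n\in\mathbb R^{np\times np}$, each viewed as an $n\times n$ array of $p\times p$ blocks $(\widetilde W^s)_{a,b}$, satisfying: (i) the only possibly nonzero blocks $(\widetilde W^1)_{a,b}$ of $\widetilde W^1$ are those with $a,b\in\{1,2\}$, and the only possibly nonzero blocks $(\widetilde W^n)_{a,b}$ of $\widetilde W^n$ are those with $a,b\in\{n-1,n\}$; (ii) for each $s=2,\ldots,n-1$, the only possibly nonzero blocks $(\widetilde W^s)_{a,b}$ of $\widetilde W^s$ are those with $a,b\in\{s-1,s,s+1\}$, and moreover $(\widetilde W^s)_{s-1,s+1}=0$ and $(\widetilde W^s)_{s+1,s-1}=0$; (iii) $W=\sum_{s=1}^n\widetilde W^s$. (b) If $W$ is positive definite (PD), then there exist PD matrices $\widehat W^1,\widehat W^n\in\mathbb R^{2p\times 2p}$ and $\widehat W^s\in\mathbb R^{3p\times 3p}$ for $s=2,\ldots,n-1$ such that the corresponding matrices $\widetilde W^s\in\mathbb R^{np\times np}$ satisfy (i), (ii) and (iii). Here $\widetilde W^s$ is obtained by placing $\widehat W^s$ in the block rows and columns $\{1,2\}$ if $s=1$, $\{n-1,n\}$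 if $s=n$, and $\{s-1,s,s+1\}$ if $2\le s\le n-1$, and zeros elsewhere.
   Context: PSD and PD matrices are understood to be real symmetric. $\mathbb R^n_+$ is the set of vectors in $\mathbb R^n$ with nonnegative entries. Definition of $W$. For $i=1,\ldots,n$, let $U_i\in\mathbb R^{p\times p}$ be the symmetric matrix whose $(a,b)$-entry is $(\boldsymbol\theta_{a,b})_i$, the $i$-th entry of $\boldsymbol\theta_{a,b}$. The matrix $W$ generated by the $\boldsymbol\theta_{i,j}$ is the $n\times n$ block matrix with $p\times p$ blocks $W_{i,j}$ given by $$W_{i,i}=U_i+U_{i+1},\quad W_{i,i+1}=W_{i+1,i}=-U_{i+1}\quad (i=1,\ldots,n-1),\qquad W_{n,n}=U_n,$$ and $W_{i,j}=0$ if $|i-j|\ge 2$. Equivalently, $W=E^T\,\mathbf S^{-T}\,\Theta\,\mathbf S^{-1}E$, where: $\Theta\in\mathbb R^{np\times np}$ is the $p\times p$ block matrix with $n\times n$ diagonal blocks $\Theta_{i,j}=\mathrm{diag}(\boldsymbol\theta_{i,j})$; $\mathbf S^{-1}=\mathrm{diag}(S_n^{-1},\ldots,S_n^{-1})$ ($p$ copies), with $S_n\in\mathbb R^{n\times n}$ the lower triangular matrix all of whose entries on and below the diagonal equal $1$; and $E\in\mathbb R^{np\times np}$ is the permutation matrix with $E_{a,b}=1$ if $a=nk+s$ and $b=p(s-1)+k+1$ for some $k\in\{0,\ldots,p-1\}$, $s\in\{1,\ldots,n\}$, and $E_{a,b}=0$ otherwise. *)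

theory Defs
  imports "Jordan_Normal_Form.Matrix"
begin

text \<open>
  Following \<^theory>\<open>Jordan_Normal_Form.Matrix\<close>, all indices are 0-based: blocks, entries inside
  a block, the indices of the \<open>\<theta> i j\<close> and the summands \<open>s\<close> run over \<open>0, \<dots>, n - 1\<close>
  resp. \<open>0, \<dots>, p - 1\<close> instead of \<open>1, \<dots>, n\<close> resp. \<open>1, \<dots>, p\<close>.
\<close>

definition psd :: "real mat \<Rightarrow> bool" where
  "psd A \<longleftrightarrow> square_mat A \<and> transpose_mat A = A \<and>
     (\<forall>v \<in> carrier_vec (dim_row A). 0 \<le> v \<bullet> (A *\<^sub>v v))"

definition pd :: "real mat \<Rightarrow> bool" where
  "pd A \<longleftrightarrow> square_mat A \<and> transpose_mat A = A \<and>
     (\<forall>v \<in> carrier_vec (dim_row A). v \<noteq> 0\<^sub>v (dim_row A) \<longrightarrow> 0 < v \<bullet> (A *\<^sub>v v))"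

definition block :: "nat \<Rightarrow> real mat \<Rightarrow> nat \<Rightarrow> nat \<Rightarrow> real mat" where
  "block p A a b = mat p p (\<lambda>(i, j). A $$ (a * p + i, b * p + j))"

definition U_mat :: "nat \<Rightarrow> (nat \<Rightarrow> nat \<Rightarrow> real vec) \<Rightarrow> nat \<Rightarrow> real mat" where
  "U_mat p \<theta> i = mat p p (\<lambda>(a, b). \<theta> a b $ i)"

definition W_block :: "nat \<Rightarrow> nat \<Rightarrow> (nat \<Rightarrow> nat \<Rightarrow> real vec) \<Rightarrow> nat \<Rightarrow> nat \<Rightarrow> real mat" where
  "W_block n p \<theta> i j =
     (if i = j then (if i = n - 1 then U_mat p \<theta> i else U_mat p \<theta> i + U_mat p \<theta> (i + 1))
      else if j = i + 1 then - U_mat p \<theta> j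
      else if i = j + 1 then - U_mat p \<theta> i
      else 0\<^sub>m p p)"

definition W_mat :: "nat \<Rightarrow> nat \<Rightarrow> (nat \<Rightarrow> nat \<Rightarrow> real vec) \<Rightarrow> real mat" where
  "W_mat n p \<theta> = mat (n * p) (n * p)
     (\<lambda>(i, j). W_block n p \<theta> (i div p) (j div p) $$ (i mod p, j mod p))"

definition supported_on :: "nat \<Rightarrow> nat \<Rightarrow> nat set \<Rightarrow> real mat \<Rightarrow> bool" where
  "supported_on n p I A \<longleftrightarrow>
     (\<forall>a<n. \<forall>b<n. \<not> (a \<in> I \<and> b \<in> I) \<longrightarrow> block p A a b = 0\<^sub>m p p)"

text \<open>
  The sum is written out entrywise, because \<^typ>\<open>real mat\<close>, whose elements may have any
  dimensions, is not an instance of \<^class>\<open>comm_monoid_add\<close>.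
\<close>

definition block_decomposition :: "nat \<Rightarrow> nat \<Rightarrow> real mat \<Rightarrow> (nat \<Rightarrow> real mat) \<Rightarrow> bool" where
  "block_decomposition n p W Wt \<longleftrightarrow>
     supported_on n p {0, 1} (Wt 0) \<and>
     supported_on n p {n - 2, n - 1} (Wt (n - 1)) \<and>
     (\<forall>s. 1 \<le> s \<and> s < n - 1 \<longrightarrow>
        supported_on n p {s - 1, s, s + 1} (Wt s) \<and>
        block p (Wt s) (s - 1) (s + 1) = 0\<^sub>m p p \<and>
        block p (Wt s) (s + 1) (s - 1) = 0\<^sub>m p p) \<and>
     W = mat (n * p) (n * p) (\<lambda>(i, j). \<Sum>s<n. Wt s $$ (i, j))"

definition place_at :: "nat \<Rightarrow> nat \<Rightarrow> nat \<Rightarrow> real mat \<Rightarrow> real mat" where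
  "place_at n p m A = mat (n * p) (n * p)
     (\<lambda>(i, j). if m * p \<le> i \<and> i < m * p + dim_row A \<and> m * p \<le> j \<and> j < m * p + dim_col A
       then A $$ (i - m * p, j - m * p) else 0)"

definition embed_summand :: "nat \<Rightarrow> nat \<Rightarrow> nat \<Rightarrow> real mat \<Rightarrow> real mat" where
  "embed_summand n p s A =
     (if s = 0 then place_at n p 0 A
      else if s = n - 1 then place_at n p (n - 2) A
      else place_at n p (s - 1) A)"

end

theory Submission
  imports Defs "HOL-Analysis.Function_Topology"
begin

text \<open>
  With \<open>x\<^sub>-\<^sub>1 = 0\<close>, the quadratic form of \<open>W\<close> is the sum over \<open>s\<close> of the form of \<open>U\<^sub>s\<close> at
  \<open>x\<^sub>s - x\<^sub>s\<^sub>-\<^sub>1\<close>. Since these differences are independent, \<open>W\<close> is semidefinite (definite) iff every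
  \<open>U\<^sub>s\<close> is, and in the semidefinite case the terms of this sum are the required summands. In the
  definite case choose \<open>\<mu> > 0\<close> with \<open>U\<^sub>s \<ge> \<mu> I\<close> for all \<open>s\<close> and add to the \<open>s\<close>-th term the block
  diagonal matrix with blocks \<open>\<mu> D\<^sub>s(a) I\<close>, where the scalars \<open>D\<^sub>s(a)\<close> vanish for
  \<open>a \<notin> {s - 1, s, s + 1}\<close>, satisfy \<open>\<Sum>\<^sub>s D\<^sub>s(a) = 0\<close>, and make the scalar form
  \<open>(x\<^sub>s - x\<^sub>s\<^sub>-\<^sub>1)\<^sup>2 + \<Sum>\<^sub>a D\<^sub>s(a) x\<^sub>a\<^sup>2\<close> positive definite on the window of \<open>s\<close>.
\<close>

section \<open>Quadratic forms, definiteness and coercivity\<close>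

definition qform :: "real mat \<Rightarrow> nat \<Rightarrow> (nat \<Rightarrow> real) \<Rightarrow> real" where
  "qform A N v = (\<Sum>i<N. \<Sum>j<N. A $$ (i, j) * v i * v j)"

lemma qform_cong: "(\<And>i. i < N \<Longrightarrow> v i = w i) \<Longrightarrow> qform A N v = qform A N w"
  unfolding qform_def by (intro sum.cong refl) auto

lemma qform_scale: "qform A N (\<lambda>i. c * v i) = c\<^sup>2 * qform A N v"
  by (simp add: qform_def sum_distrib_left power2_eq_square algebra_simps)

lemma scalar_prod_mult_mat_vec_eq_qform:
  assumes "A \<in> carrier_mat N N" "v \<in> carrier_vec N"
  shows "v \<bullet> (A *\<^sub>v v) = qform A N (\<lambda>i. v $ i)"
  using assms
  by (auto simp: qform_def scalar_prod_def atLeast0LessThan sum_distrib_left algebra_simps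
      intro!: sum.cong)

lemma qform_eq_scalar_prod:
  assumes "A \<in> carrier_mat N N"
  shows "qform A N v = vec N v \<bullet> (A *\<^sub>v vec N v)"
  using scalar_prod_mult_mat_vec_eq_qform[OF assms vec_carrier, of v]
  by (simp cong: qform_cong)

lemma psd_iff_qform:
  assumes A: "A \<in> carrier_mat N N"
  shows "psd A \<longleftrightarrow> transpose_mat A = A \<and> (\<forall>v. 0 \<le> qform A N v)"
proof -
  have "(\<forall>v \<in> carrier_vec N. 0 \<le> v \<bullet> (A *\<^sub>v v)) \<longleftrightarrow> (\<forall>v. 0 \<le> qform A N v)"
    using scalar_prod_mult_mat_vec_eq_qform[OF A] qform_eq_scalar_prod[OF A] vec_carrier
    by metis
  then show ?thesis
    using A by (auto simp: psd_def)
qed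

lemma pd_iff_qform:
  assumes A: "A \<in> carrier_mat N N"
  shows "pd A \<longleftrightarrow> transpose_mat A = A \<and> (\<forall>v. (\<exists>i<N. v i \<noteq> 0) \<longrightarrow> 0 < qform A N v)"
proof -
  have nz: "v \<noteq> 0\<^sub>v N \<longleftrightarrow> (\<exists>i<N. v $ i \<noteq> 0)" if "v \<in> carrier_vec N" for v :: "real vec"
    using that by (auto simp: vec_eq_iff)
  have "(\<forall>v \<in> carrier_vec N. v \<noteq> 0\<^sub>v N \<longrightarrow> 0 < v \<bullet> (A *\<^sub>v v)) \<longleftrightarrow>
      (\<forall>v. (\<exists>i<N. v i \<noteq> 0) \<longrightarrow> 0 < qform A N v)" (is "?L \<longleftrightarrow> ?R")
  proof
    assume L: ?L
    show ?R
    proof (intro allI impI)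
      fix v :: "nat \<Rightarrow> real" assume "\<exists>i<N. v i \<noteq> 0"
      then have "vec N v \<noteq> 0\<^sub>v N" by (subst nz) auto
      with L show "0 < qform A N v" by (simp add: qform_eq_scalar_prod[OF A])
    qed
  next
    assume ?R
    then show ?L by (simp add: scalar_prod_mult_mat_vec_eq_qform[OF A] nz)
  qed
  then show ?thesis
    using A by (auto simp: pd_def)
qed

text \<open>Extensionality puts the singleton \<open>{undefined}\<close> in every factor from
  \<open>N\<close> on, so the cube is a product of compact sets in
  \<open>nat \<Rightarrow> real\<close> and Tychonoff's theorem applies.\<close>

lemma compact_cube: "compact (PiE {..<N::nat} (\<lambda>_. {-1..1::real}))"
proof -
  let ?C = "\<lambda>i. if i < N then {-1..1::real} else {undefined}"
  have "compactin (product_topology (\<lambda>_. euclidean) UNIV) (PiE UNIV ?C)"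
    unfolding compactin_PiE by (intro disjI2 ballI) simp
  then have "compact (PiE UNIV ?C)"
    unfolding euclidean_product_topology compactin_euclidean_iff .
  moreover have "PiE {..<N} (\<lambda>_. {-1..1::real}) = PiE UNIV ?C"
  proof (rule Set.set_eqI)
    fix f
    show "f \<in> PiE {..<N} (\<lambda>_. {-1..1::real}) \<longleftrightarrow> f \<in> PiE UNIV ?C"
      unfolding PiE_iff extensional_def by (simp; safe; fastforce split: if_splits)
  qed
  ultimately show ?thesis by simp
qed

text \<open>The minimum of the form on the compact unit sphere is positive and serves as \<mu>;
  homogeneity extends the bound to all vectors.\<close>

lemma qform_coercive:
  assumes pos: "\<And>v. \<exists>i<N. v i \<noteq> 0 \<Longrightarrow> 0 < qform A N v"
  shows "\<exists>\<mu>>0. \<forall>v. \<mu> * (\<Sum>i<N. (v i)\<^sup>2) \<le> qform A N v"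
proof (cases "N = 0")
  case True
  then show ?thesis by (auto simp: qform_def intro!: exI[of _ 1])
next
  case False
  define S where "S = {v \<in> PiE {..<N} (\<lambda>_. {-1..1::real}). (\<Sum>i<N. (v i)\<^sup>2) = 1}"
  have cont: "continuous_on UNIV (\<lambda>v::nat \<Rightarrow> real. v i)" for i
    by (rule continuous_on_product_coordinates)
  have "S = PiE {..<N} (\<lambda>_. {-1..1}) \<inter> {v. (\<Sum>i<N. (v i)\<^sup>2) = 1}"
    by (auto simp: S_def)
  moreover have "closed {v::nat \<Rightarrow> real. (\<Sum>i<N. (v i)\<^sup>2) = 1}"
    by (intro closed_Collect_eq continuous_intros cont)
  ultimately have "compact S"
    using compact_cube compact_Int_closed by metis
  moreover have "restrict (\<lambda>i. if i = 0 then 1 else 0) {..<N} \<in> S"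
    using False by (auto simp: S_def if_distrib[where f="\<lambda>x. x\<^sup>2"] cong: if_cong)
  then have "S \<noteq> {}" by blast
  moreover have "continuous_on S (qform A N)"
    unfolding qform_def
    by (intro continuous_intros continuous_on_subset[OF cont]) auto
  ultimately obtain u where u: "u \<in> S" "\<And>v. v \<in> S \<Longrightarrow> qform A N u \<le> qform A N v"
    by (metis continuous_attains_inf)
  have "\<exists>i<N. u i \<noteq> 0"
    using u(1) by (force simp: S_def)
  then have "0 < qform A N u" by (rule pos)
  moreover have "qform A N u * (\<Sum>i<N. (v i)\<^sup>2) \<le> qform A N v" for v
  proof (cases "\<exists>i<N. v i \<noteq> 0")
    case False
    then show ?thesis by (simp add: qform_def)
  next
    case True
    define r where "r = (\<Sum>i<N. (v i)\<^sup>2)"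
    have "0 < r"
      unfolding r_def using True by (auto intro!: sum_pos2)
    define w where "w = restrict (\<lambda>i. inverse (sqrt r) * v i) {..<N}"
    have one: "(\<Sum>i<N. (w i)\<^sup>2) = 1"
    proof -
      have "(\<Sum>i<N. (w i)\<^sup>2) = inverse r * r"
        \<comment> \<open>This unfolds \<open>r\<close> only as the right factor of a product, so
          that \<open>inverse r\<close> stays intact.\<close>
        unfolding r_def[of, THEN arg_cong, of "\<lambda>x. _ * x"] w_def sum_distrib_left
        using \<open>0 < r\<close> by (intro sum.cong) (auto simp: power_mult_distrib power_inverse)
      then show ?thesis using \<open>0 < r\<close> by simp
    qed
    have "(w i)\<^sup>2 \<le> 1" if "i < N" for i
      unfolding one[symmetric] by (rule member_le_sum) (use that in auto)
    then have "w i \<in> {-1..1}" if "i < N" for i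
      using that abs_square_le_1[of "w i"] by (auto simp: abs_le_iff)
    then have "w \<in> S"
      using one by (auto simp: S_def w_def PiE_iff)
    then have "qform A N u \<le> qform A N w" by (rule u(2))
    also have "\<dots> = qform A N (\<lambda>i. inverse (sqrt r) * v i)"
      by (rule qform_cong) (simp add: w_def)
    also have "\<dots> = qform A N v / r"
      using \<open>0 < r\<close> unfolding qform_scale by (simp add: power_inverse field_simps)
    finally show ?thesis
      using \<open>0 < r\<close> by (simp add: r_def[symmetric] field_simps)
  qed
  ultimately show ?thesis by blast
qed

section \<open>Block matrices built from one matrix \<open>U\<close>\<close>

lemma sum_lessThan_blocks:
  fixes f :: "nat \<Rightarrow> 'a :: comm_monoid_add"
  shows "(\<Sum>i<w * p. f i) = (\<Sum>a<w. \<Sum>k<p. f (a * p + k))"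
proof -
  have "(\<Sum>k<p. f (a * p + k)) = sum f {a * p..<a * p + p}" for a
    using sum.shift_bounds_nat_ivl[of f 0 "a * p" p]
    by (simp add: atLeast0LessThan add.commute)
  then show ?thesis by (simp add: sum.nat_group)
qed

lemma less_blocks: "a < n \<Longrightarrow> k < p \<Longrightarrow> a * p + k < n * (p::nat)"
proof -
  assume "a < n" "k < p"
  then have "a * p + k < Suc a * p" by simp
  also have "\<dots> \<le> n * p" using \<open>a < n\<close> by (intro mult_le_mono1) simp
  finally show ?thesis .
qed

text \<open>This is the Kronecker product of g g^T with \<open>U\<close> plus that of Diag(D) with
  the identity. The summands of both decompositions have this form, before and after
  embedding.\<close>

definition rank_one_block_mat ::
    "nat \<Rightarrow> nat \<Rightarrow> (nat \<Rightarrow> real) \<Rightarrow> (nat \<Rightarrow> real) \<Rightarrow> real mat \<Rightarrow> real mat" where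
  "rank_one_block_mat w p g D U = mat (w * p) (w * p) (\<lambda>(i, j).
     g (i div p) * g (j div p) * U $$ (i mod p, j mod p) + (if i = j then D (i div p) else 0))"

lemma rank_one_block_mat_carrier [simp]:
  "rank_one_block_mat w p g D U \<in> carrier_mat (w * p) (w * p)"
  by (simp add: rank_one_block_mat_def)

lemma transpose_rank_one_block_mat:
  assumes "U \<in> carrier_mat p p" "transpose_mat U = U"
  shows "transpose_mat (rank_one_block_mat w p g D U) = rank_one_block_mat w p g D U"
proof (rule eq_matI)
  have sym: "U $$ (k, l) = U $$ (l, k)" if "k < p" "l < p" for k l
    using that assms by (metis carrier_matD index_transpose_mat(1))
  fix i j
  assume "i < dim_row (rank_one_block_mat w p g D U)" "j < dim_col (rank_one_block_mat w p g D U)"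
  then have ij: "i < w * p" "j < w * p" by (simp_all add: rank_one_block_mat_def)
  then have "0 < p" by (cases p) auto
  then show "transpose_mat (rank_one_block_mat w p g D U) $$ (i, j) =
      rank_one_block_mat w p g D U $$ (i, j)"
    using ij sym[of "i mod p" "j mod p"] by (simp add: rank_one_block_mat_def)
qed (simp_all add: rank_one_block_mat_def)

text \<open>Flat indices split as \<open>a * p + k\<close>; bilinearity then moves the sums over
  blocks inside the form of \<open>U\<close>.\<close>

lemma qform_rank_one_block_mat:
  "qform (rank_one_block_mat w p g D U) (w * p) v =
     qform U p (\<lambda>k. \<Sum>a<w. g a * v (a * p + k)) +
     (\<Sum>k<p. \<Sum>a<w. D a * (v (a * p + k))\<^sup>2)"
proof -
  let ?h = "\<lambda>i. g (i div p) * v i"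
  have "qform (rank_one_block_mat w p g D U) (w * p) v =
      (\<Sum>i<w * p. \<Sum>j<w * p. U $$ (i mod p, j mod p) * ?h i * ?h j +
        (if i = j then D (i div p) * (v i)\<^sup>2 else 0))"
    unfolding qform_def
    by (intro sum.cong refl) (auto simp: rank_one_block_mat_def power2_eq_square algebra_simps)
  also have "\<dots> = (\<Sum>i<w * p. \<Sum>j<w * p. U $$ (i mod p, j mod p) * ?h i * ?h j) +
      (\<Sum>i<w * p. D (i div p) * (v i)\<^sup>2)"
    by (simp add: sum.distrib)
  also have "(\<Sum>i<w * p. D (i div p) * (v i)\<^sup>2) = (\<Sum>a<w. \<Sum>k<p. D a * (v (a * p + k))\<^sup>2)"
    unfolding sum_lessThan_blocks by (intro sum.cong refl) auto
  also have "\<dots> = (\<Sum>k<p. \<Sum>a<w. D a * (v (a * p + k))\<^sup>2)"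
    by (rule sum.swap)
  also have "(\<Sum>i<w * p. \<Sum>j<w * p. U $$ (i mod p, j mod p) * ?h i * ?h j) =
      (\<Sum>a<w. \<Sum>k<p. \<Sum>b<w. \<Sum>l<p.
         U $$ (k, l) * (g a * v (a * p + k)) * (g b * v (b * p + l)))"
    unfolding sum_lessThan_blocks by (intro sum.cong refl) auto
  also have "\<dots> = (\<Sum>k<p. \<Sum>a<w. \<Sum>l<p. \<Sum>b<w.
         U $$ (k, l) * (g a * v (a * p + k)) * (g b * v (b * p + l)))"
    by (subst sum.swap) (intro sum.cong refl sum.swap)
  also have "\<dots> = (\<Sum>k<p. \<Sum>l<p. \<Sum>a<w. \<Sum>b<w.
         U $$ (k, l) * (g a * v (a * p + k)) * (g b * v (b * p + l)))"
    by (intro sum.cong refl sum.swap)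
  also have "\<dots> = qform U p (\<lambda>k. \<Sum>a<w. g a * v (a * p + k))"
    unfolding qform_def mult.assoc sum_product
    by (simp add: mult.assoc sum_distrib_left mult.left_commute)
  finally show ?thesis .
qed

text \<open>Shifting by \<open>m * p\<close> preserves residues modulo \<open>p\<close> and moves
  block indices by \<open>m\<close>, so coefficients that vanish off the window already produce the
  zero padding.\<close>

lemma place_at_rank_one_block_mat:
  assumes "m + w \<le> n"
    and "\<And>a. a < n \<Longrightarrow> a < m \<or> m + w \<le> a \<Longrightarrow> g a = 0 \<and> D a = 0"
  shows "place_at n p m (rank_one_block_mat w p (\<lambda>a. g (m + a)) (\<lambda>a. D (m + a)) U) =
    rank_one_block_mat n p g D U"
proof (rule eq_matI)
  fix i j
  assume "i < dim_row (rank_one_block_mat n p g D U)" "j < dim_col (rank_one_block_mat n p g D U)"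
  then have ij: "i < n * p" "j < n * p" by (simp_all add: rank_one_block_mat_def)
  then have "0 < p" by (cases p) auto
  then have div: "i div p < n" "j div p < n"
    using ij by (simp_all add: less_mult_imp_div_less)
  have window: "m * p \<le> x \<and> x < m * p + w * p \<longleftrightarrow> m \<le> x div p \<and> x div p < m + w" for x
    using \<open>0 < p\<close>
    by (auto simp: less_eq_div_iff_mult_less_eq div_less_iff_less_mult distrib_right)
  have shift: "m + (x - m * p) div p = x div p" "(x - m * p) mod p = x mod p"
    if "m \<le> x div p" for x
  proof -
    from that obtain r where "x = m * p + r"
      using \<open>0 < p\<close> by (metis le_iff_add less_eq_div_iff_mult_less_eq)
    then show "m + (x - m * p) div p = x div p" "(x - m * p) mod p = x mod p"
      using \<open>0 < p\<close> by simp_all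
  qed
  show "place_at n p m (rank_one_block_mat w p (\<lambda>a. g (m + a)) (\<lambda>a. D (m + a)) U) $$ (i, j) =
      rank_one_block_mat n p g D U $$ (i, j)"
  proof (cases "(m \<le> i div p \<and> i div p < m + w) \<and> (m \<le> j div p \<and> j div p < m + w)")
    case True
    moreover from this have "m * p \<le> i" "m * p \<le> j" "i - m * p < w * p" "j - m * p < w * p"
      using window[of i] window[of j] by auto
    moreover from this have "i - m * p = j - m * p \<longleftrightarrow> i = j" by auto
    ultimately show ?thesis
      using ij window[of i] window[of j] shift[of i] shift[of j]
      by (auto simp: place_at_def rank_one_block_mat_def)
  next
    case False
    then have "\<not> ((m * p \<le> i \<and> i < m * p + w * p) \<and> (m * p \<le> j \<and> j < m * p + w * p))"
      unfolding window .
    then have "place_at n p m (rank_one_block_mat w p (\<lambda>a. g (m + a)) (\<lambda>a. D (m + a)) U)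
        $$ (i, j) = 0"
      using ij by (auto simp: place_at_def rank_one_block_mat_def)
    moreover have "rank_one_block_mat n p g D U $$ (i, j) = 0"
      using False assms(2)[OF div(1)] assms(2)[OF div(2)] ij
      by (auto simp: rank_one_block_mat_def)
    ultimately show ?thesis by simp
  qed
qed (simp_all add: place_at_def rank_one_block_mat_def)

section \<open>The backward difference matrix (the inverse of S_n) and the splitting of W\<close>

definition bdiff :: "nat \<Rightarrow> nat \<Rightarrow> real" where
  "bdiff s a = (if a = s then 1 else 0) - (if a + 1 = s then 1 else 0)"

lemma U_mat_carrier [simp]: "U_mat p \<theta> s \<in> carrier_mat p p"
  by (simp add: U_mat_def)

lemma transpose_U_mat:
  assumes "\<forall>i<p. \<forall>j<p. \<theta> i j = \<theta> j i"
  shows "transpose_mat (U_mat p \<theta> s) = U_mat p \<theta> s"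
  using assms by (intro eq_matI) (auto simp: U_mat_def)

lemma sum_bdiff_left:
  assumes "a < n"
  shows "(\<Sum>s<n. bdiff s a * f s) = f a - (if a + 1 < n then f (a + 1) else 0)"
proof -
  have "(\<Sum>s<n. bdiff s a * f s) =
      (\<Sum>s<n. if a = s then f s else 0) - (\<Sum>s<n. if a + 1 = s then f s else 0)"
    unfolding sum_subtractf[symmetric] by (intro sum.cong refl) (auto simp: bdiff_def)
  then show ?thesis
    using assms by simp
qed

lemma sum_bdiff_right:
  assumes "s < n"
  shows "(\<Sum>a<n. bdiff s a * f a) = f s - (if s = 0 then 0 else f (s - 1))"
proof -
  \<comment> \<open>For \<open>s = 0\<close> the truncated \<open>s - 1\<close> is 0, where no -1
    stands; the inner test discards it.\<close>
  have "(\<Sum>a<n. bdiff s a * f a) =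
      (\<Sum>a<n. if a = s then f a else 0) - (\<Sum>a<n. if a = s - 1 then if s = 0 then 0 else f a else 0)"
    unfolding sum_subtractf[symmetric] by (intro sum.cong refl) (auto simp: bdiff_def)
  also have "(\<Sum>a<n. if a = s then f a else 0) = f s"
    using assms by simp
  also have "(\<Sum>a<n. if a = s - 1 then if s = 0 then 0 else f a else 0) =
      (if s = 0 then 0 else f (s - 1))"
    using assms by (subst sum.delta) auto
  finally show ?thesis .
qed

text \<open>As \<open>bdiff s a\<close> is the entry \<open>(s, a)\<close> of the inverse of S_n,
  this is the factorization of W through Theta, read block by block. Column \<open>a\<close> is
  nonzero only in rows \<open>a\<close> and \<open>a + 1\<close>; the last column lacks the second,
  whence the single \<open>U\<close> in the last diagonal block.\<close>

lemma W_block_eq_sum: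
  assumes "a < n" "b < n" "k < p" "l < p"
  shows "W_block n p \<theta> a b $$ (k, l) =
    (\<Sum>s<n. bdiff s a * bdiff s b * U_mat p \<theta> s $$ (k, l))"
proof -
  have "(\<Sum>s<n. bdiff s a * bdiff s b * U_mat p \<theta> s $$ (k, l)) =
      bdiff a b * U_mat p \<theta> a $$ (k, l) -
      (if a + 1 < n then bdiff (a + 1) b * U_mat p \<theta> (a + 1) $$ (k, l) else 0)"
    using sum_bdiff_left[OF assms(1), of "\<lambda>s. bdiff s b * U_mat p \<theta> s $$ (k, l)"]
    by (simp add: mult.assoc)
  then show ?thesis
    using assms by (auto simp: W_block_def bdiff_def U_mat_def)
qed

text \<open>The \<open>D s\<close> enter only on the diagonal and cancel in the sum over
  \<open>s\<close>; this freedom is what later makes the summands definite.\<close>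

lemma W_mat_eq_sum:
  assumes "\<And>a. a < n \<Longrightarrow> (\<Sum>s<n. D s a) = 0"
  shows "W_mat n p \<theta> = mat (n * p) (n * p)
    (\<lambda>(i, j). \<Sum>s<n. rank_one_block_mat n p (bdiff s) (D s) (U_mat p \<theta> s) $$ (i, j))"
proof (rule eq_matI; simp add: W_mat_def)
  fix i j assume ij: "i < n * p" "j < n * p"
  then have "0 < p" by (cases p) auto
  with ij have "i div p < n" "j div p < n" "i mod p < p" "j mod p < p"
    by (simp_all add: less_mult_imp_div_less)
  then show "W_block n p \<theta> (i div p) (j div p) $$ (i mod p, j mod p) =
      (\<Sum>s<n. rank_one_block_mat n p (bdiff s) (D s) (U_mat p \<theta> s) $$ (i, j))"
    using ij assms[of "j div p"]
    by (cases "i = j") (simp_all add: W_block_eq_sum rank_one_block_mat_def sum.distrib)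
qed

text \<open>On a staircase vector only the \<open>s\<close>-th backward difference is nonzero.\<close>

lemma qform_W_mat_staircase:
  assumes "s < n"
  shows "qform (W_mat n p \<theta>) (n * p) (\<lambda>i. if s \<le> i div p then v (i mod p) else 0) =
    qform (U_mat p \<theta> s) p v"
proof -
  let ?v = "\<lambda>i. if s \<le> i div p then v (i mod p) else 0"
  let ?R = "\<lambda>t. rank_one_block_mat n p (bdiff t) (\<lambda>_. 0) (U_mat p \<theta> t)"
  have "qform (W_mat n p \<theta>) (n * p) ?v = (\<Sum>t<n. qform (?R t) (n * p) ?v)"
  proof -
    have "qform (W_mat n p \<theta>) (n * p) ?v =
        (\<Sum>i<n * p. \<Sum>j<n * p. \<Sum>t<n. ?R t $$ (i, j) * ?v i * ?v j)"
      unfolding qform_def W_mat_eq_sum[of n "\<lambda>_ _. 0" p \<theta>, OF sum.neutral_const]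
      by (intro sum.cong refl) (simp only: lessThan_iff index_mat case_prod_conv sum_distrib_right)
    also have "\<dots> = (\<Sum>i<n * p. \<Sum>t<n. \<Sum>j<n * p. ?R t $$ (i, j) * ?v i * ?v j)"
      by (intro sum.cong refl sum.swap)
    also have "\<dots> = (\<Sum>t<n. qform (?R t) (n * p) ?v)"
      unfolding qform_def by (rule sum.swap)
    finally show ?thesis .
  qed
  also have "\<dots> = (\<Sum>t<n. if t = s then qform (U_mat p \<theta> s) p v else 0)"
  proof (intro sum.cong refl)
    fix t assume "t \<in> {..<n}"
    then have "(\<Sum>a<n. bdiff t a * ?v (a * p + k)) = (if t = s then v k else 0)" if "k < p" for k
      using that by (auto simp: sum_bdiff_right)
    then have "qform (?R t) (n * p) ?v = qform (U_mat p \<theta> t) p (\<lambda>k. if t = s then v k else 0)"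
      unfolding qform_rank_one_block_mat by (simp cong: qform_cong)
    then show "qform (?R t) (n * p) ?v = (if t = s then qform (U_mat p \<theta> s) p v else 0)"
      by (simp add: qform_def)
  qed
  also have "\<dots> = qform (U_mat p \<theta> s) p v"
    using assms by simp
  finally show ?thesis .
qed

text \<open>The rank one part of summand \<open>s\<close> lives on blocks \<open>s - 1\<close> and
  \<open>s\<close>, while \<open>D s\<close> adds only diagonal blocks. So block
  \<open>s + 1\<close> meets no other block, and the two corner blocks vanish.\<close>

lemma block_decomposition_W_mat:
  assumes n: "2 \<le> n"
    and D: "\<And>s a. s < n \<Longrightarrow> a < n \<Longrightarrow> a \<notin> {s - 1, s, s + 1} \<Longrightarrow> D s a = 0"
    and sumD: "\<And>a. a < n \<Longrightarrow> (\<Sum>s<n. D s a) = 0"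
  shows "block_decomposition n p (W_mat n p \<theta>)
    (\<lambda>s. rank_one_block_mat n p (bdiff s) (D s) (U_mat p \<theta> s))"
proof -
  let ?R = "\<lambda>s. rank_one_block_mat n p (bdiff s) (D s) (U_mat p \<theta> s)"
  have zero: "block p (?R s) a b = 0\<^sub>m p p"
    if "a < n" "b < n" "bdiff s a = 0 \<or> bdiff s b = 0" "a \<noteq> b \<or> D s a = 0" for s a b
  proof (rule eq_matI)
    fix k l assume "k < dim_row (0\<^sub>m p p :: real mat)" "l < dim_col (0\<^sub>m p p :: real mat)"
    then have kl: "k < p" "l < p" by simp_all
    moreover have "a * p + k = b * p + l \<Longrightarrow> a = b"
      using kl by (metis div_mult_self3 div_less add_0_right less_nat_zero_code)
    ultimately show "block p (?R s) a b $$ (k, l) = 0\<^sub>m p p $$ (k, l)"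
      using that by (auto simp: block_def rank_one_block_mat_def less_blocks)
  qed (simp_all add: block_def)
  have supp: "supported_on n p I (?R s)"
    if "s < n" "\<And>a. a < n \<Longrightarrow> a \<in> {s - 1, s, s + 1} \<Longrightarrow> a \<in> I" for s I
    unfolding supported_on_def
  proof (intro allI impI)
    fix a b assume "a < n" "b < n" "\<not> (a \<in> I \<and> b \<in> I)"
    moreover from this have "a \<notin> {s - 1, s, s + 1} \<or> b \<notin> {s - 1, s, s + 1}"
      using that(2) by blast
    ultimately show "block p (?R s) a b = 0\<^sub>m p p"
      using D[OF \<open>s < n\<close>] by (intro zero) (auto simp: bdiff_def)
  qed
  \<comment> \<open>For \<open>s = 0\<close> truncation merges \<open>s - 1\<close> with
    \<open>s\<close>; for \<open>s = n - 1\<close> the position \<open>s + 1\<close> is out of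
    range.\<close>
  have "supported_on n p {0, 1} (?R 0)" "supported_on n p {n - 2, n - 1} (?R (n - 1))"
    by (rule supp; use n in auto)+
  moreover have "supported_on n p {s - 1, s, s + 1} (?R s)"
    "block p (?R s) (s - 1) (s + 1) = 0\<^sub>m p p" "block p (?R s) (s + 1) (s - 1) = 0\<^sub>m p p"
    if "1 \<le> s" "s < n - 1" for s
    using that by (auto intro!: supp zero simp: bdiff_def)
  ultimately show ?thesis
    unfolding block_decomposition_def using W_mat_eq_sum[of n D, OF sumD] by blast
qed

lemma block_decomposition_cong:
  assumes "2 \<le> n" "\<And>s. s < n \<Longrightarrow> A s = B s"
  shows "block_decomposition n p W A \<longleftrightarrow> block_decomposition n p W B"
proof -
  have "A 0 = B 0" "A (n - 1) = B (n - 1)" "\<And>s. 1 \<le> s \<and> s < n - 1 \<Longrightarrow> A s = B s"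
    by (rule assms(2); use assms(1) in auto)+
  moreover have "(\<Sum>s<n. A s $$ ij) = (\<Sum>s<n. B s $$ ij)" for ij
    by (intro sum.cong) (simp_all add: assms(2))
  ultimately show ?thesis
    unfolding block_decomposition_def by (simp only: cong: imp_cong)
qed

section \<open>Scalar corrections and positive definite windows\<close>

text \<open>
  The coefficient at \<open>a = s - 1\<close> lies strictly between \<open>1 / (2 * s + 1)\<close> and \<open>1 / (2 * s)\<close>: the
  lower bound makes \<open>(x\<^sub>s - x\<^sub>s\<^sub>-\<^sub>1)\<^sup>2 + window_diag n s (s - 1) * x\<^sub>s\<^sub>-\<^sub>1\<^sup>2 - x\<^sub>s\<^sup>2 / (2 * s + 2)\<close>
  positive definite, the upper bound leaves a positive surplus for position \<open>s + 1\<close>.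
\<close>

definition window_diag :: "nat \<Rightarrow> nat \<Rightarrow> nat \<Rightarrow> real" where
  "window_diag n s a =
    (let c = 2 / (4 * real a + 5); d = 1 / (2 * real a + 2) in
     if a + 1 = s then c
     else if a = s then - d + (if a = 0 then d - c else 0) + (if a = n - 1 then c else 0)
     else if a = s + 1 then d - c
     else 0)"

lemma window_diag_outside: "a \<notin> {s - 1, s, s + 1} \<Longrightarrow> window_diag n s a = 0"
  by (auto simp: window_diag_def Let_def)

text \<open>In the interior, block \<open>a\<close> receives \<open>c\<close> from window
  \<open>a + 1\<close>, \<open>- d\<close> from window \<open>a\<close> and \<open>d - c\<close>
  from window \<open>a - 1\<close>. At either end one neighbour is missing, and window
  \<open>a\<close> takes over its share.\<close>

lemma sum_window_diag:
  assumes "a < n"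
  shows "(\<Sum>s<n. window_diag n s a) = 0"
proof -
  let ?c = "2 / (4 * real a + 5)" and ?d = "1 / (2 * real a + 2)"
  have "(\<Sum>s<n. window_diag n s a) =
      (\<Sum>s<n. (if s = a + 1 then ?c else 0) +
        (if s = a then - ?d + (if a = 0 then ?d - ?c else 0) + (if a = n - 1 then ?c else 0) else 0) +
        (if s = a - 1 then if a = 0 then 0 else ?d - ?c else 0))"
    by (intro sum.cong refl) (auto simp: window_diag_def Let_def)
  also have "\<dots> = 0"
    unfolding sum.distrib using assms by (simp add: sum.delta) auto
  finally show ?thesis .
qed

text \<open>Every window starts at \<open>s - 1\<close>, truncated to 0 for \<open>s = 0\<close>, so
  the width alone separates the end windows from the inner ones.\<close>

definition window_width :: "nat \<Rightarrow> nat \<Rightarrow> nat" where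
  "window_width n s = (if s = 0 \<or> s = n - 1 then 2 else 3)"

text \<open>Multiplying by \<open>1 + c\<close> allows completing the square. The second assumption
  says that the matrix with rows (1 + c, -1) and (-1, 1 - d) has positive determinant.\<close>

lemma binary_form_pos:
  fixes c d x y :: real
  assumes "0 < 1 + c" "1 < (1 + c) * (1 - d)" "x \<noteq> 0 \<or> y \<noteq> 0"
  shows "0 < (y - x)\<^sup>2 + c * x\<^sup>2 - d * y\<^sup>2"
proof -
  have "(1 + c) * ((y - x)\<^sup>2 + c * x\<^sup>2 - d * y\<^sup>2) =
      ((1 + c) * x - y)\<^sup>2 + ((1 + c) * (1 - d) - 1) * y\<^sup>2"
    by (simp add: power2_eq_square algebra_simps)
  also have "\<dots> > 0"
  proof (cases "y = 0")
    case False
    then show ?thesis using assms(2) by (intro add_nonneg_pos) auto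
  qed (use assms in auto)
  finally show ?thesis
    using assms(1) by (simp add: zero_less_mult_iff)
qed

text \<open>For \<open>s > 0\<close> the difference touches only the first two positions, where
  \<open>binary_form_pos\<close> applies; a third position adds a separate positive square.\<close>

lemma window_form_pos:
  fixes t :: "nat \<Rightarrow> real"
  assumes "2 \<le> n" "s < n" "\<exists>a<window_width n s. t a \<noteq> 0"
  shows "0 < (\<Sum>a<window_width n s. bdiff s (s - 1 + a) * t a)\<^sup>2 +
    (\<Sum>a<window_width n s. window_diag n s (s - 1 + a) * (t a)\<^sup>2)" (is "0 < ?q")
proof (cases s)
  case 0
  then have w: "window_width n s = 2" by (simp add: window_width_def)
  \<comment> \<open>No block precedes block 0, so the form is diagonal, with coefficients 1 - 2/5
    and 1/4 - 2/9.\<close>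
  have "?q = 3 / 5 * (t 0)\<^sup>2 + 1 / 36 * (t 1)\<^sup>2"
    unfolding w using 0 \<open>2 \<le> n\<close>
    by (simp add: bdiff_def window_diag_def Let_def numeral_2_eq_2 algebra_simps)
  moreover have "t 0 \<noteq> 0 \<or> t 1 \<noteq> 0"
    using assms(3) unfolding w by (auto simp: numeral_2_eq_2 less_Suc_eq)
  then have "0 < 3 / 5 * (t 0)\<^sup>2 + 1 / 36 * (t 1)\<^sup>2"
    by (auto intro: add_nonneg_pos add_pos_nonneg)
  ultimately show ?thesis by simp
next
  case (Suc r)
  define c where "c = 2 / (4 * real r + 5)"
  define d where "d = 1 / (2 * real r + 4)"
  have c: "0 < 1 + c" by (simp add: c_def add_pos_nonneg)
  \<comment> \<open>Cleared of denominators: 8 r^2 + 26 r + 20 < 8 r^2 + 26 r + 21.\<close>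
  have cd: "1 < (1 + c) * (1 - d)"
    unfolding c_def d_def
    by (simp add: divide_simps) (simp add: algebra_simps add_nonneg_pos not_less)
  have g: "bdiff (Suc r) r = - 1" "bdiff (Suc r) (Suc r) = 1"
    "bdiff (Suc r) (Suc (Suc r)) = 0"
    by (simp_all add: bdiff_def)
  have Dr: "window_diag n (Suc r) r = c"
    by (simp add: window_diag_def c_def)
  show ?thesis
  proof (cases "n = Suc (Suc r)")
    case True
    then have w: "window_width n s = 2" by (simp add: window_width_def Suc)
    \<comment> \<open>\<open>e\<close> is the share of the missing window \<open>n\<close> at the
      last block; it only reduces the weight \<open>d\<close> that is subtracted.\<close>
    define e where "e = 2 / (4 * real r + 9)"
    have "0 < e" by (simp add: e_def)
    have D: "window_diag n (Suc r) (Suc r) = - (d - e)"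
      by (simp add: True window_diag_def Let_def d_def e_def add.commute)
    have q: "?q = (t 1 - t 0)\<^sup>2 + c * (t 0)\<^sup>2 - (d - e) * (t 1)\<^sup>2"
      unfolding w unfolding Suc numeral_2_eq_2 sum.lessThan_Suc
      by (simp add: g Dr D left_diff_distrib)
    have de: "1 < (1 + c) * (1 - (d - e))"
      using add_strict_mono[OF cd mult_pos_pos[OF c \<open>0 < e\<close>]] by (simp add: algebra_simps)
    have nz: "t 0 \<noteq> 0 \<or> t 1 \<noteq> 0"
      using assms(3) unfolding w by (auto simp: numeral_2_eq_2 less_Suc_eq)
    show ?thesis
      unfolding q by (rule binary_form_pos[OF c de nz])
  next
    case False
    with assms(2) have w: "window_width n s = 3" by (auto simp: window_width_def Suc)
    define e where "e = 1 / (2 * real r + 6) - 2 / (4 * real r + 13)"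
    have "0 < e" by (simp add: e_def divide_simps)
    have D: "window_diag n (Suc r) (Suc r) = - d" "window_diag n (Suc r) (Suc (Suc r)) = e"
      using False assms(2) by (auto simp: Suc window_diag_def Let_def d_def e_def add.commute)
    have q: "?q = ((t 1 - t 0)\<^sup>2 + c * (t 0)\<^sup>2 - d * (t 1)\<^sup>2) + e * (t 2)\<^sup>2"
      unfolding w unfolding Suc numeral_2_eq_2 numeral_3_eq_3 sum.lessThan_Suc
      by (simp add: g Dr D)
    have nz: "t 0 \<noteq> 0 \<or> t 1 \<noteq> 0 \<or> t 2 \<noteq> 0"
      using assms(3) unfolding w by (auto simp: numeral_3_eq_3 numeral_2_eq_2 less_Suc_eq)
    show ?thesis
    proof (cases "t 0 \<noteq> 0 \<or> t 1 \<noteq> 0")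
      case True
      have "0 \<le> e * (t 2)\<^sup>2"
        using \<open>0 < e\<close> by simp
      then show ?thesis
        unfolding q by (intro add_pos_nonneg binary_form_pos[OF c cd True])
    next
      case False
      with nz have "0 < e * (t 2)\<^sup>2"
        using \<open>0 < e\<close> by simp
      then show ?thesis
        unfolding q using False by simp
    qed
  qed
qed

text \<open>Coercivity bounds the form of \<open>U\<close> below by \<mu> times a sum of squares.
  This decouples the coordinates inside a block: each \<open>k\<close> contributes \<mu> times the
  scalar window form of the slice \<open>v (a * p + k)\<close>.\<close>

lemma pd_window_mat:
  assumes "2 \<le> n" "s < n" "0 < \<mu>"
    and U: "U \<in> carrier_mat p p" "transpose_mat U = U"
    and coercive: "\<And>v. \<mu> * (\<Sum>k<p. (v k)\<^sup>2) \<le> qform U p v"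
  shows "pd (rank_one_block_mat (window_width n s) p (\<lambda>a. bdiff s (s - 1 + a))
    (\<lambda>a. \<mu> * window_diag n s (s - 1 + a)) U)" (is "pd (rank_one_block_mat ?w p ?g ?D U)")
proof -
  let ?q = "\<lambda>t. (\<Sum>a<?w. ?g a * t a)\<^sup>2 +
    (\<Sum>a<?w. window_diag n s (s - 1 + a) * (t a)\<^sup>2)"
  have q_pos: "0 < ?q t" if "\<exists>a<?w. t a \<noteq> 0" for t
    using window_form_pos[OF assms(1,2) that] .
  have q_nonneg: "0 \<le> ?q t" for t
    using q_pos[of t] by (cases "\<exists>a<?w. t a \<noteq> 0") auto
  have "0 < qform (rank_one_block_mat ?w p ?g ?D U) (?w * p) v" if "\<exists>i<?w * p. v i \<noteq> 0" for v
  proof -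
    from that obtain i where i: "i < ?w * p" "v i \<noteq> 0" by blast
    then have "0 < p" by (cases p) auto
    have "0 < (\<Sum>k<p. ?q (\<lambda>a. v (a * p + k)))"
    proof (rule sum_pos2)
      show "i mod p \<in> {..<p}" using \<open>0 < p\<close> by simp
      have "i div p < ?w" using i(1) by (rule less_mult_imp_div_less)
      then show "0 < ?q (\<lambda>a. v (a * p + i mod p))"
        using i(2) by (intro q_pos exI[of _ "i div p"]) simp
    qed (use q_nonneg in auto)
    then have "0 < \<mu> * (\<Sum>k<p. ?q (\<lambda>a. v (a * p + k)))"
      using \<open>0 < \<mu>\<close> by simp
    also have "\<dots> = \<mu> * (\<Sum>k<p. (\<Sum>a<?w. ?g a * v (a * p + k))\<^sup>2) +
        (\<Sum>k<p. \<Sum>a<?w. ?D a * (v (a * p + k))\<^sup>2)"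
      by (simp add: sum.distrib sum_distrib_left distrib_left mult.assoc)
    also have "\<dots> \<le> qform (rank_one_block_mat ?w p ?g ?D U) (?w * p) v"
      unfolding qform_rank_one_block_mat using coercive by simp
    finally show ?thesis .
  qed
  then show ?thesis
    using pd_iff_qform[OF rank_one_block_mat_carrier] transpose_rank_one_block_mat[OF U]
    by blast
qed

section \<open>Passing definiteness from W to the \<open>U_mat p \<theta> s\<close> and on to the
  summands\<close>

theorem proposition4p1:
  fixes n p :: nat and \<theta> :: "nat \<Rightarrow> nat \<Rightarrow> real vec"
  assumes "2 \<le> n" and "1 \<le> p"
    and "\<forall>i<p. \<forall>j<p. \<theta> i j \<in> carrier_vec n"
    and "\<forall>i<p. \<forall>j<p. \<theta> i j = \<theta> j i"
    and "\<forall>i<p. \<forall>j<p. \<forall>k<n. 0 \<le> \<theta> i j $ k"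
  shows "(psd (W_mat n p \<theta>) \<longrightarrow>
           (\<exists>Wt :: nat \<Rightarrow> real mat.
              (\<forall>s<n. Wt s \<in> carrier_mat (n * p) (n * p) \<and> psd (Wt s)) \<and>
              block_decomposition n p (W_mat n p \<theta>) Wt)) \<and>
         (pd (W_mat n p \<theta>) \<longrightarrow>
           (\<exists>Wh :: nat \<Rightarrow> real mat.
              Wh 0 \<in> carrier_mat (2 * p) (2 * p) \<and>
              Wh (n - 1) \<in> carrier_mat (2 * p) (2 * p) \<and>
              (\<forall>s. 1 \<le> s \<and> s < n - 1 \<longrightarrow> Wh s \<in> carrier_mat (3 * p) (3 * p)) \<and>
              (\<forall>s<n. pd (Wh s)) \<and>
              block_decomposition n p (W_mat n p \<theta>) (\<lambda>s. embed_summand n p s (Wh s))))"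
proof (intro conjI impI)
  note n = \<open>2 \<le> n\<close>
  note transpose_U = transpose_U_mat[OF assms(4)]
  have W: "W_mat n p \<theta> \<in> carrier_mat (n * p) (n * p)"
    by (simp add: W_mat_def)
  {
    assume psd: "psd (W_mat n p \<theta>)"
    let ?R = "\<lambda>s. rank_one_block_mat n p (bdiff s) (\<lambda>_. 0) (U_mat p \<theta> s)"
    \<comment> \<open>Testing W on staircase vectors gives semidefiniteness of each
      \<open>U_mat p \<theta> s\<close>.\<close>
    have "0 \<le> qform (U_mat p \<theta> s) p v" if "s < n" for s v
      using psd unfolding qform_W_mat_staircase[OF that, symmetric] psd_iff_qform[OF W] by blast
    then have "psd (?R s)" if "s < n" for s
      using that psd_iff_qform[OF rank_one_block_mat_carrier]
      by (simp add: qform_rank_one_block_mat transpose_rank_one_block_mat transpose_U)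
    moreover have "block_decomposition n p (W_mat n p \<theta>) ?R"
      by (rule block_decomposition_W_mat[OF n]) simp_all
    ultimately show "\<exists>Wt. (\<forall>s<n. Wt s \<in> carrier_mat (n * p) (n * p) \<and> psd (Wt s)) \<and>
        block_decomposition n p (W_mat n p \<theta>) Wt"
      by (intro exI[of _ ?R]) simp
  }
  assume pd: "pd (W_mat n p \<theta>)"
  have "0 < qform (U_mat p \<theta> s) p v" if "s < n" "\<exists>k<p. v k \<noteq> 0" for s v
  proof -
    from that(2) obtain k where k: "k < p" "v k \<noteq> 0" by blast
    let ?x = "\<lambda>i. if s \<le> i div p then v (i mod p) else 0"
    have "\<exists>i<n * p. ?x i \<noteq> 0"
      using k less_blocks[OF \<open>s < n\<close> k(1)] by (intro exI[of _ "s * p + k"]) simp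
    moreover have "(\<exists>i<n * p. ?x i \<noteq> 0) \<longrightarrow> 0 < qform (W_mat n p \<theta>) (n * p) ?x"
      using pd unfolding pd_iff_qform[OF W] by (elim conjE allE)
    ultimately show ?thesis
      unfolding qform_W_mat_staircase[OF that(1)] by simp
  qed
  \<comment> \<open>The bound is vacuous for \<open>s\<close> out of range, so one function
    \<open>m\<close> can be chosen for all \<open>s\<close>.\<close>
  then have "\<forall>s. \<exists>\<mu>>0. s < n \<longrightarrow> (\<forall>v. \<mu> * (\<Sum>k<p. (v k)\<^sup>2) \<le> qform (U_mat p \<theta> s) p v)"
    by (metis qform_coercive zero_less_one)
  then obtain m where m_pos: "\<And>s. 0 < m s"
    and m: "\<And>s v. s < n \<Longrightarrow> m s * (\<Sum>k<p. (v k)\<^sup>2) \<le> qform (U_mat p \<theta> s) p v"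
    by metis
  \<comment> \<open>The corrections cancel in the sum over \<open>s\<close> because they all carry
    the same factor; hence one constant for all \<open>s\<close>.\<close>
  define \<mu> where "\<mu> = Min (m ` {..<n})"
  have "0 < \<mu>"
    unfolding \<mu>_def using n m_pos by (subst Min_gr_iff) (auto simp: lessThan_empty_iff)
  have \<mu>: "\<mu> * (\<Sum>k<p. (v k)\<^sup>2) \<le> qform (U_mat p \<theta> s) p v" if "s < n" for s v
  proof -
    have "\<mu> \<le> m s" unfolding \<mu>_def using that by simp
    then have "\<mu> * (\<Sum>k<p. (v k)\<^sup>2) \<le> m s * (\<Sum>k<p. (v k)\<^sup>2)"
      by (intro mult_right_mono sum_nonneg) auto
    with m[OF that, of v] show ?thesis by linarith
  qed
  define Wh where "Wh s = rank_one_block_mat (window_width n s) p (\<lambda>a. bdiff s (s - 1 + a))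
    (\<lambda>a. \<mu> * window_diag n s (s - 1 + a)) (U_mat p \<theta> s)" for s
  have pd_Wh: "pd (Wh s)" if "s < n" for s
    unfolding Wh_def by (rule pd_window_mat[OF n that \<open>0 < \<mu>\<close> U_mat_carrier transpose_U \<mu>[OF that]])
  have embed: "embed_summand n p s (Wh s) =
      rank_one_block_mat n p (bdiff s) (\<lambda>a. \<mu> * window_diag n s a) (U_mat p \<theta> s)" if "s < n" for s
  proof -
    \<comment> \<open>All three offsets equal \<open>s - 1\<close>: truncation covers
      \<open>s = 0\<close>, and \<open>n - 2\<close> is \<open>s - 1\<close> for
      \<open>s = n - 1\<close>.\<close>
    have "embed_summand n p s (Wh s) = place_at n p (s - 1) (Wh s)"
      by (auto simp: embed_summand_def numeral_2_eq_2)
    also have "\<dots> = rank_one_block_mat n p (bdiff s) (\<lambda>a. \<mu> * window_diag n s a) (U_mat p \<theta> s)"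
      unfolding Wh_def
      by (rule place_at_rank_one_block_mat[where D = "\<lambda>a. \<mu> * window_diag n s a"])
        (use n that in \<open>auto simp: window_width_def bdiff_def intro!: window_diag_outside
            split: if_splits\<close>)
    finally show ?thesis .
  qed
  have "block_decomposition n p (W_mat n p \<theta>)
      (\<lambda>s. rank_one_block_mat n p (bdiff s) (\<lambda>a. \<mu> * window_diag n s a) (U_mat p \<theta> s))"
    by (rule block_decomposition_W_mat[OF n])
      (simp_all add: window_diag_outside sum_window_diag sum_distrib_left[symmetric])
  then have "block_decomposition n p (W_mat n p \<theta>) (\<lambda>s. embed_summand n p s (Wh s))"
    by (subst block_decomposition_cong[OF n embed])
  moreover have "Wh 0 \<in> carrier_mat (2 * p) (2 * p)" "Wh (n - 1) \<in> carrier_mat (2 * p) (2 * p)"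
    "\<forall>s. 1 \<le> s \<and> s < n - 1 \<longrightarrow> Wh s \<in> carrier_mat (3 * p) (3 * p)"
    unfolding Wh_def by (auto simp: rank_one_block_mat_def window_width_def)
  ultimately show "\<exists>Wh. Wh 0 \<in> carrier_mat (2 * p) (2 * p) \<and>
      Wh (n - 1) \<in> carrier_mat (2 * p) (2 * p) \<and>
      (\<forall>s. 1 \<le> s \<and> s < n - 1 \<longrightarrow> Wh s \<in> carrier_mat (3 * p) (3 * p)) \<and>
      (\<forall>s<n. pd (Wh s)) \<and>
      block_decomposition n p (W_mat n p \<theta>) (\<lambda>s. embed_summand n p s (Wh s))"
    using pd_Wh by blast
qed

end
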